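(* Let $G^{w}$ be a connected dual number weighted graph on $n$ vertices, and partition its Laplacian matrix as $L_{w}=\begin{bmatrix}\widetilde{L}_{11}&\widetilde{L}_{12}\\ \widetilde{L}_{12}^{T}&\widetilde{L}_{22}\end{bmatrix}$ with $\widetilde{L}_{11}\in\mathbb{D}^{(n-1)\times(n-1)}$. Then $\widetilde{L}_{11}$ is invertible, $\begin{bmatrix}\widetilde{L}_{11}^{-1}&0\\0&0\end{bmatrix}$ is a $\{1\}$-inverse of $L_{w}$, and the set of all $\{1\}$-inverses of $L_{w}$ is $$\left\{\begin{bmatrix}\widetilde{L}_{11}^{-1}&0\\0&0\end{bmatrix}+\begin{bmatrix}0&\mathbf{1}\\0&1\end{bmatrix}P+Q\begin{bmatrix}0&0\\ \mathbf{1}^{T}&1\end{bmatrix}: P,Q\in\mathbb{D}^{n\times n}\right\},$$ where $\mathbf{1}$ is the all-ones vector of length $n-1$.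
   Context: Dual numbers: $\mathbb{D}=\{a_s+a_d\varepsilon: a_s,a_d\in\mathbb{R}\}$ with $\varepsilon\neq 0$, $\varepsilon^2=0$. For $A\in\mathbb{D}^{m\times n}$, a $\{1\}$-inverse is any $X\in\mathbb{D}^{n\times m}$ with $AXA=A$; a square dual matrix $A$ is invertible if some $B$ satisfies $AB=BA=I$. Dual number weighted graph: given a graph $G=(V,E)$ with $V=[n]$ and reals $\widehat{a}_e$ ($e\in E$), each edge $e$ gets weight $w(e)=1+\widehat{a}_e\varepsilon$. Its adjacency matrix $A_w$ has $(i,j)$ entry $1+\widehat{a}_{e}\varepsilon$ if $e=\{i,j\}\in E$ and $0$ otherwise; its degree matrix $D_w$ is diagonal with $i$-th entry $\sum_j (A_w)_{ij}$; its Laplacian matrix is $L_w=D_w-A_w$. $G^w$ is connected if $G$ is. *)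

theory Defs
  imports Complex_Main "Jordan_Normal_Form.Matrix"
begin

section \<open>Dual numbers\<close>

datatype dual_number = Dual (std_part: real) (inf_part: real)

instantiation dual_number :: real_algebra_1
begin

definition "0 = Dual 0 0"
definition "1 = Dual 1 0"
definition "x + y = Dual (std_part x + std_part y) (inf_part x + inf_part y)"
definition "- x = Dual (- std_part x) (- inf_part x)"
definition "x - y = Dual (std_part x - std_part y) (inf_part x - inf_part y)"
definition "x * y = Dual (std_part x * std_part y)
  (std_part x * inf_part y + inf_part x * std_part y)"
definition "c *\<^sub>R x = Dual (c * std_part x) (c * inf_part x)"

instance
  by standard
    (simp_all add: zero_dual_number_def one_dual_number_def plus_dual_number_def
      uminus_dual_number_def minus_dual_number_def times_dual_number_def
      scaleR_dual_number_def algebra_simps)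

end

instance dual_number :: comm_ring_1
  by standard
    (simp_all only: times_dual_number_def one_dual_number_def plus_dual_number_def
      dual_number.sel dual_number.inject, simp_all add: algebra_simps)

definition eps :: dual_number
  where "eps = Dual 0 1"

lemma eps_neq_0: "eps \<noteq> 0"
  by (simp add: eps_def zero_dual_number_def)

lemma eps_square: "eps\<^sup>2 = 0"
  by (simp add: eps_def power2_eq_square times_dual_number_def zero_dual_number_def)

lemma Dual_eq: "Dual a b = of_real a + of_real b * eps"
  by (simp add: eps_def of_real_def scaleR_dual_number_def one_dual_number_def
      plus_dual_number_def times_dual_number_def)


section \<open>Matrices over dual numbers\<close>

definition one_inverses :: "'a :: semiring_0 mat \<Rightarrow> 'a mat set"
  where "one_inverses A = {X \<in> carrier_mat (dim_col A) (dim_row A). A * X * A = A}"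

text \<open>The library's \<open>mat_inverse\<close> is restricted to matrices over a field.
  The following is meaningful for invertible matrices only; there it is the two-sided
  inverse, by \<open>inv_mat_eqI\<close>.\<close>

definition inv_mat :: "'a :: semiring_1 mat \<Rightarrow> 'a mat"
  where "inv_mat A = (THE B. inverts_mat A B \<and> inverts_mat B A)"

lemma inv_mat_eqI:
  fixes A :: "'a :: semiring_1 mat"
  assumes sq: "square_mat A" and AB: "inverts_mat A B" and BA: "inverts_mat B A"
  shows "inv_mat A = B"
  unfolding inv_mat_def
proof (rule the_equality)
  define n where "n = dim_row A"
  have A: "A \<in> carrier_mat n n"
    using sq by (auto simp: n_def)
  have carrier: "X \<in> carrier_mat n n" if "inverts_mat A X" "inverts_mat X A" for X
  proof -
    have "dim_col (A * X) = n" "dim_col (X * A) = dim_row X"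
      using that by (simp_all add: inverts_mat_def n_def)
    then show ?thesis
      using A by auto
  qed
  show "inverts_mat A B \<and> inverts_mat B A"
    using AB BA by simp
  fix C assume C: "inverts_mat A C \<and> inverts_mat C A"
  note B' = carrier[OF AB BA] and C' = carrier[of C]
  have "C = C * (A * B)"
    using AB C C' A by (simp add: inverts_mat_def)
  also have "\<dots> = (C * A) * B"
    using assoc_mult_mat[of C n n A n B n] C C' A B' by simp
  also have "\<dots> = B"
    using C C' B' by (simp add: inverts_mat_def)
  finally show "C = B" .
qed

definition ones_col :: "nat \<Rightarrow> 'a :: one mat"
  where "ones_col k = mat k 1 (\<lambda>_. 1)"


section \<open>Dual number weighted graphs\<close>

text \<open>Graphs are finite, simple and undirected.  To agree with the indexing of matrices, the
  vertex set \<open>[n]\<close> is \<open>{0..<n}\<close> rather than \<open>{1..n}\<close>.  An edge is a two-element set of vertices.\<close>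

definition simple_graph :: "nat \<Rightarrow> nat set set \<Rightarrow> bool"
  where "simple_graph n E \<longleftrightarrow> (\<forall>e\<in>E. e \<subseteq> {0..<n} \<and> card e = 2)"

definition connected_graph :: "nat \<Rightarrow> nat set set \<Rightarrow> bool"
  where "connected_graph n E \<longleftrightarrow> simple_graph n E \<and> n \<noteq> 0 \<and>
    (\<forall>i<n. \<forall>j<n. (i, j) \<in> {(u, v). {u, v} \<in> E}\<^sup>*)"

text \<open>The values of \<open>a\<close> outside the edge set play no role.\<close>

definition weight :: "(nat set \<Rightarrow> real) \<Rightarrow> nat set \<Rightarrow> dual_number"
  where "weight a e = 1 + of_real (a e) * eps"

definition adjacency_mat :: "nat \<Rightarrow> nat set set \<Rightarrow> (nat set \<Rightarrow> real) \<Rightarrow> dual_number mat"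
  where "adjacency_mat n E a = mat n n (\<lambda>(i, j). if {i, j} \<in> E then weight a {i, j} else 0)"

definition degree_mat :: "nat \<Rightarrow> nat set set \<Rightarrow> (nat set \<Rightarrow> real) \<Rightarrow> dual_number mat"
  where "degree_mat n E a =
    mat n n (\<lambda>(i, j). if i = j then \<Sum>k<n. adjacency_mat n E a $$ (i, k) else 0)"

definition laplacian_mat :: "nat \<Rightarrow> nat set set \<Rightarrow> (nat set \<Rightarrow> real) \<Rightarrow> dual_number mat"
  where "laplacian_mat n E a = degree_mat n E a - adjacency_mat n E a"

lemma laplacian_mat_carrier [simp]:
  "dim_row (laplacian_mat n E a) = n" "dim_col (laplacian_mat n E a) = n"
  by (simp_all add: laplacian_mat_def degree_mat_def adjacency_mat_def)

lemma laplacian_mat_sym: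
  assumes "i < n" "j < n"
  shows "laplacian_mat n E a $$ (i, j) = laplacian_mat n E a $$ (j, i)"
proof (cases "i = j")
  case False
  have "{i, j} = {j, i}"
    by blast
  with False assms show ?thesis
    by (simp add: laplacian_mat_def degree_mat_def adjacency_mat_def)
qed simp

lemma laplacian_mat_partition:
  assumes "n \<noteq> 0"
  obtains L11 L12 L22 where
    "L11 \<in> carrier_mat (n - 1) (n - 1)" "L12 \<in> carrier_mat (n - 1) 1" "L22 \<in> carrier_mat 1 1"
    "laplacian_mat n E a = four_block_mat L11 L12 (transpose_mat L12) L22"
proof -
  define L where "L = laplacian_mat n E a"
  obtain m where n: "n = Suc m"
    using assms not0_implies_Suc by blast
  have dim: "dim_row L = Suc m" "dim_col L = Suc m"
    by (simp_all add: L_def n)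
  have sym: "L $$ (m, j) = L $$ (j, m)" if "j < m" for j
    unfolding L_def by (rule laplacian_mat_sym) (use that n in simp_all)
  define L11 where "L11 = mat m m (\<lambda>ij. L $$ ij)"
  define L12 where "L12 = mat m 1 (\<lambda>(i, j). L $$ (i, m))"
  define L22 where "L22 = mat 1 1 (\<lambda>ij. L $$ (m, m))"
  have "L = four_block_mat L11 L12 (transpose_mat L12) L22"
    by (rule eq_matI)
      (auto simp: L11_def L12_def L22_def dim sym less_Suc_eq)
  moreover have "L11 \<in> carrier_mat (n - 1) (n - 1)" "L12 \<in> carrier_mat (n - 1) 1"
    "L22 \<in> carrier_mat 1 1"
    by (simp_all add: L11_def L12_def L22_def n)
  ultimately show ?thesis
    using that unfolding L_def by blast
qed

end

theory Submission
  imports Defs "Jordan_Normal_Form.Determinant"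
begin

text \<open>
  A dual matrix is invertible as soon as its standard part is, since its determinant is then
  a unit. The standard part of the grounded Laplacian is that of the unweighted graph, and it has
  trivial kernel by the maximum principle: a function that vanishes at the last vertex and is
  harmonic elsewhere attains its maximum and its minimum at that vertex.

  All \<open>{1}\<close>-inverses of \<open>A\<close> arise from a single one, \<open>M\<close>, as
  \<open>M + (I - M A) P + Q (I - A M)\<close>. Since the rows and columns of the Laplacian sum to zero,
  \<open>I - M L\<close> and \<open>I - L M\<close> are the block matrices built from the all-ones vector when
  \<open>M\<close> is the bordered inverse of the grounded Laplacian.
\<close>

section \<open>All {1}-inverses from a single one\<close>

lemma minus_zero_mat:
  fixes A :: "'a :: group_add mat"
  shows "A \<in> carrier_mat nr nc \<Longrightarrow> A - 0\<^sub>m nr nc = A"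
  by (intro eq_matI) auto

text \<open>\<open>A\<close> kills \<open>1 - M * A\<close> from the left and
  \<open>1 - A * M\<close> from the right, so the added terms vanish in \<open>A * X * A\<close>.
  Conversely, \<open>Y = X - M\<close> satisfies \<open>A * Y * A = 0\<close>, and this is enough to
  split \<open>Y\<close> into terms of the two required shapes.\<close>

lemma one_inverses_eq:
  fixes A M :: "'a :: ring_1 mat"
  assumes A: "A \<in> carrier_mat nr nc" and M: "M \<in> one_inverses A"
  shows "one_inverses A =
    {M + (1\<^sub>m nc - M * A) * P + Q * (1\<^sub>m nr - A * M)
     | P Q. P \<in> carrier_mat nc nr \<and> Q \<in> carrier_mat nc nr}" (is "_ = ?R")
proof -
  have Mc: "M \<in> carrier_mat nc nr" and AMA: "A * M * A = A"
    using A M by (auto simp: one_inverses_def)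
  have MA: "M * A \<in> carrier_mat nc nc" and AM: "A * M \<in> carrier_mat nr nr"
    using A Mc by auto
  define U where "U = 1\<^sub>m nc - M * A"
  define V where "V = 1\<^sub>m nr - A * M"
  have U: "U \<in> carrier_mat nc nc" and V: "V \<in> carrier_mat nr nr"
    unfolding U_def V_def using minus_carrier_mat[OF MA] minus_carrier_mat[OF AM] by auto
  have AU: "A * U = 0\<^sub>m nr nc"
    unfolding U_def using A Mc MA AMA
    by (simp add: mult_minus_distrib_mat[OF A _ MA])
  have VA: "V * A = 0\<^sub>m nr nc"
    unfolding V_def using A Mc AM AMA
    by (simp add: minus_mult_distrib_mat[OF _ AM A])
  {
    fix X assume X: "X \<in> ?R"
    then obtain P Q where P: "P \<in> carrier_mat nc nr" and Q: "Q \<in> carrier_mat nc nr"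
      and X: "X = M + U * P + Q * V"
      unfolding U_def V_def by blast
    have UP: "U * P \<in> carrier_mat nc nr" and QV: "Q * V \<in> carrier_mat nc nr"
      using U V P Q by auto
    have "A * X = A * M + A * (U * P) + A * (Q * V)"
      unfolding X using mult_add_distrib_mat[OF A _ QV, of "M + U * P"]
        mult_add_distrib_mat[OF A Mc UP] Mc UP by simp
    also have "A * (U * P) = 0\<^sub>m nr nr"
      using assoc_mult_mat[OF A U P] AU P by simp
    finally have AX: "A * X = A * M + A * (Q * V)"
      using AM by simp
    have "A * X * A = A + A * (Q * V) * A"
      unfolding AX using A AM QV AMA
        add_mult_distrib_mat[OF AM _ A, of "A * (Q * V)"] by simp
    also have "A * (Q * V) * A = A * (Q * (V * A))"
      using assoc_mult_mat[OF A QV A] assoc_mult_mat[OF Q V A] by simp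
    also have "\<dots> = 0\<^sub>m nr nc"
      using A Q VA by simp
    finally have "X \<in> one_inverses A"
      using A U V P Q Mc by (simp add: one_inverses_def X)
  }
  moreover
  {
    fix X assume "X \<in> one_inverses A"
    then have X: "X \<in> carrier_mat nc nr" and AXA: "A * X * A = A"
      using A by (auto simp: one_inverses_def)
    define Y where "Y = X - M"
    have Y: "Y \<in> carrier_mat nc nr"
      unfolding Y_def using Mc by auto
    have MAY: "M * A * Y \<in> carrier_mat nc nr"
      using MA Y by simp
    have AX: "A * X \<in> carrier_mat nr nr" and AY: "A * Y \<in> carrier_mat nr nr"
      using A X Y by auto
    have "A * Y * A = 0\<^sub>m nr nc"
      unfolding Y_def using mult_minus_distrib_mat[OF A X Mc]
        minus_mult_distrib_mat[OF AX AM A] AXA AMA A by simp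
    moreover have "M * A * Y * (A * M) = M * (A * Y * A) * M"
      using assoc_mult_mat[OF MAY A Mc] assoc_mult_mat[OF Mc A Y]
        assoc_mult_mat[OF Mc AY A] by simp
    ultimately have 0: "M * A * Y * (A * M) = 0\<^sub>m nc nr"
      using Mc by simp
    have "U * Y = Y - M * A * Y"
      unfolding U_def using minus_mult_distrib_mat[OF _ MA Y, of "1\<^sub>m nc"] Y by simp
    moreover have "M * A * Y * V = M * A * Y"
      unfolding V_def using mult_minus_distrib_mat[OF MAY _ AM, of "1\<^sub>m nr"] 0
        right_mult_one_mat[OF MAY] minus_zero_mat[OF MAY] by simp
    \<comment> \<open>The witnesses are \<open>P = Y\<close> and \<open>Q = M * A * Y\<close>: the
      first term gives \<open>Y - M * A * Y\<close>, and the second restores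
      \<open>M * A * Y\<close>, which \<open>V\<close> fixes from the right.\<close>
    ultimately have "M + U * Y + (M * A * Y) * V = X"
      using MAY Mc X by (intro eq_matI) (auto simp: Y_def)
    then have "X \<in> ?R"
      using Y MAY unfolding U_def V_def by blast
  }
  ultimately show ?thesis
    by blast
qed

section \<open>The Laplacian as a difference operator, and harmonic functions\<close>

lemma laplacian_mat_index:
  assumes "simple_graph n E" "i < n" "j < n"
  shows "laplacian_mat n E a $$ (i, j) =
    (if i = j then \<Sum>k | k < n \<and> {i, k} \<in> E. weight a {i, k}
     else if {i, j} \<in> E then - weight a {i, j} else 0)"
proof -
  \<comment> \<open>On the diagonal \<open>{i, i}\<close> collapses to the singleton
    \<open>{i}\<close>, so the adjacency matrix contributes nothing there.\<close>
  have "{i} \<notin> E"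
    using assms(1) by (auto simp: simple_graph_def)
  moreover have "(\<Sum>k<n. adjacency_mat n E a $$ (i, k))
    = (\<Sum>k | k < n \<and> {i, k} \<in> E. weight a {i, k})"
    using assms by (simp add: adjacency_mat_def sum.inter_filter[symmetric])
  ultimately show ?thesis
    using assms by (auto simp: laplacian_mat_def degree_mat_def adjacency_mat_def)
qed

text \<open>The difference form serves twice: constant \<open>f\<close> yields zero row sums, and
  its standard part, where all weights are 1, is the harmonicity condition of the maximum
  principle.\<close>

lemma laplacian_mat_mult_sum:
  assumes "simple_graph n E" "i < n"
  shows "(\<Sum>j<n. laplacian_mat n E a $$ (i, j) * f j) =
    (\<Sum>j | j < n \<and> {i, j} \<in> E. weight a {i, j} * (f i - f j))"
proof -
  let ?N = "{j. j < n \<and> {i, j} \<in> E}"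
  have i: "i \<notin> ?N"
    using assms(1) by (auto simp: simple_graph_def)
  have "(\<Sum>j<n. laplacian_mat n E a $$ (i, j) * f j) =
    (\<Sum>j<n. (if j = i then (\<Sum>k\<in>?N. weight a {i, k}) * f i else 0)
       - (if {i, j} \<in> E then weight a {i, j} * f j else 0))"
    using assms i by (intro sum.cong) (auto simp: laplacian_mat_index)
  also have "\<dots> = (\<Sum>k\<in>?N. weight a {i, k}) * f i - (\<Sum>j\<in>?N. weight a {i, j} * f j)"
    using assms by (simp add: sum_subtractf sum.inter_filter[symmetric])
  also have "\<dots> = (\<Sum>j\<in>?N. weight a {i, j} * (f i - f j))"
    by (simp add: sum_distrib_right sum_subtractf right_diff_distrib)
  finally show ?thesis .
qed

lemma laplacian_mat_row_sum:
  assumes "simple_graph n E" "i < n"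
  shows "(\<Sum>j<n. laplacian_mat n E a $$ (i, j)) = 0"
  using laplacian_mat_mult_sum[OF assms, of a "\<lambda>_. 1"] by simp

lemma transpose_laplacian_mat: "transpose_mat (laplacian_mat n E a) = laplacian_mat n E a"
  by (rule eq_matI) (auto simp: laplacian_mat_sym)

text \<open>Each column of the right factor is zero or the all-ones vector. With \<open>b\<close>
  the last vertex, that factor is the block matrix multiplying \<open>P\<close> in the
  theorem.\<close>

lemma laplacian_mat_mult_ones:
  assumes "simple_graph n E"
  shows "laplacian_mat n E a * mat n n (\<lambda>(i, j). if j = b then 1 else 0) = 0\<^sub>m n n"
proof (rule eq_matI)
  fix i j assume "i < dim_row (0\<^sub>m n n :: dual_number mat)"
    "j < dim_col (0\<^sub>m n n :: dual_number mat)"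
  then have "i < n" "j < n"
    by simp_all
  then show "(laplacian_mat n E a * mat n n (\<lambda>(i, j). if j = b then 1 else 0)) $$ (i, j)
      = 0\<^sub>m n n $$ (i, j)"
    using laplacian_mat_row_sum[OF assms, of i a]
    by (cases "j = b") (simp_all add: scalar_prod_def atLeast0LessThan)
qed simp_all

text \<open>At a maximiser other than \<open>b\<close> the differences to the neighbours are
  nonnegative and sum to zero, so every neighbour is a maximiser too. A path from some maximiser to
  \<open>b\<close> carries the maximum to \<open>b\<close>.\<close>

lemma harmonic_le_boundary:
  fixes f :: "nat \<Rightarrow> real"
  assumes con: "connected_graph n E" and b: "b < n" and i: "i < n"
    and harm: "\<And>i. i < n \<Longrightarrow> i \<noteq> b \<Longrightarrow> (\<Sum>j | j < n \<and> {i, j} \<in> E. f i - f j) = 0"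
  shows "f i \<le> f b"
proof -
  define m where "m = Max (f ` {..<n})"
  have max: "f j \<le> m" if "j < n" for j
    unfolding m_def using that by simp
  have "m \<in> f ` {..<n}"
    unfolding m_def using i by (intro Max_in) auto
  then obtain u where u: "u < n" "f u = m"
    by auto
  \<comment> \<open>The first disjunct covers paths that pass through \<open>b\<close> early; when
    it fails, a vertex with value \<open>m\<close> differs from \<open>b\<close>, so harmonicity is
    available there.\<close>
  have "f b = m \<or> f x = m" if "(u, x) \<in> {(u, v). {u, v} \<in> E}\<^sup>*" for x
    using that
  proof (induction rule: rtrancl_induct)
    case base
    then show ?case using u by simp
  next
    case (step x y)
    show ?case
    proof (cases "f b = m")
      case False
      with step have x: "f x = m" "x \<noteq> b" and xy: "{x, y} \<in> E"
        by auto
      have "x < n" "y < n"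
        using con xy by (auto simp: connected_graph_def simple_graph_def)
      moreover have "\<forall>j\<in>{j. j < n \<and> {x, j} \<in> E}. f x - f j = 0"
        using harm[OF \<open>x < n\<close> x(2)] max x(1)
        by (subst sum_nonneg_eq_0_iff[symmetric]) auto
      ultimately show ?thesis
        using x xy by auto
    qed simp
  qed
  moreover have "(u, b) \<in> {(u, v). {u, v} \<in> E}\<^sup>*"
    using con u b by (simp add: connected_graph_def)
  ultimately have "f b = m"
    by blast
  then show ?thesis using max i by auto
qed

section \<open>Invertibility from the standard part\<close>

lemma std_part_simps [simp]:
  "std_part 0 = 0" "std_part 1 = 1" "std_part (x + y) = std_part x + std_part y"
  "std_part (x - y) = std_part x - std_part y" "std_part (x * y) = std_part x * std_part y"
  "std_part (of_real r) = r"
  by (simp_all add: zero_dual_number_def one_dual_number_def plus_dual_number_def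
      minus_dual_number_def times_dual_number_def of_real_def scaleR_dual_number_def)

text \<open>As a ring homomorphism, \<open>std_part\<close> commutes with determinants and finite
  sums.\<close>

interpretation std_part: comm_ring_hom std_part
  by unfold_locales simp_all

lemma std_part_weight [simp]: "std_part (weight a e) = 1"
  by (simp add: weight_def eps_def)

lemma dual_number_unit:
  assumes "std_part x \<noteq> 0"
  obtains y where "x * y = 1"
proof
  \<comment> \<open>Since \<open>eps\<close> squares to zero, (s + d eps)(s - d eps) = s^2, so the
    inverse is (s - d eps) / s^2.\<close>
  show "x * Dual (1 / std_part x) (- inf_part x / (std_part x)\<^sup>2) = 1"
    using assms by (simp add: times_dual_number_def one_dual_number_def power2_eq_square)
qed

text \<open>The adjugate identity holds over every commutative ring, so the adjugate divided by the
  unit \<open>det A\<close> is a two-sided inverse despite the zero divisors.\<close>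

lemma dual_mat_inverse:
  fixes A :: "dual_number mat"
  assumes A: "A \<in> carrier_mat n n" and det: "det (map_mat std_part A) \<noteq> 0"
  obtains B where "B \<in> carrier_mat n n" "A * B = 1\<^sub>m n" "B * A = 1\<^sub>m n"
proof -
  have "std_part (det A) \<noteq> 0"
    using det by simp
  then obtain c where c: "det A * c = 1"
    by (rule dual_number_unit)
  note adj = adj_mat[OF A]
  have c1: "c \<cdot>\<^sub>m (det A \<cdot>\<^sub>m 1\<^sub>m n) = 1\<^sub>m n"
    using c by (intro eq_matI) (auto simp: mult.commute)
  show ?thesis
  proof
    show "c \<cdot>\<^sub>m adj_mat A \<in> carrier_mat n n"
      using adj by simp
    show "A * (c \<cdot>\<^sub>m adj_mat A) = 1\<^sub>m n" "(c \<cdot>\<^sub>m adj_mat A) * A = 1\<^sub>m n"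
      using adj c1 by (simp_all add: mult_smult_distrib[OF A adj(1)]
          mult_smult_assoc_mat[OF adj(1) A])
  qed
qed

lemma det_grounded_laplacian:
  assumes con: "connected_graph (Suc m) E" and A: "A \<in> carrier_mat m m"
    and AL: "\<And>i j. i < m \<Longrightarrow> j < m \<Longrightarrow> A $$ (i, j) = laplacian_mat (Suc m) E a $$ (i, j)"
  shows "det (map_mat std_part A) \<noteq> 0"
proof
  let ?A = "map_mat std_part A"
  assume "det ?A = 0"
  then obtain v where v: "v \<in> carrier_vec m" "v \<noteq> 0\<^sub>v m" "?A *\<^sub>v v = 0\<^sub>v m"
    using det_0_iff_vec_prod_zero[of ?A m] A by auto
  \<comment> \<open>With value 0 at the grounded vertex \<open>m\<close>, the deleted column
    contributes nothing, so the full Laplacian acts on \<open>f\<close> in the rows below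
    \<open>m\<close> as the grounded one acts on \<open>v\<close>.\<close>
  define f where "f j = (if j < m then v $ j else 0)" for j
  have harm: "(\<Sum>j | j < Suc m \<and> {i, j} \<in> E. f i - f j) = 0" if "i < Suc m" "i \<noteq> m" for i
  proof -
    have i: "i < m" using that by simp
    \<comment> \<open>The real sum is lifted to dual numbers to apply the difference form of the
      weighted Laplacian; the infinitesimal parts of the weights disappear under
      \<open>std_part\<close>.\<close>
    have "(\<Sum>j | j < Suc m \<and> {i, j} \<in> E. f i - f j) =
      std_part (\<Sum>j | j < Suc m \<and> {i, j} \<in> E. weight a {i, j} * (of_real (f i) - of_real (f j)))"
      by (simp add: std_part.hom_sum)
    also have "\<dots> = std_part (\<Sum>j<Suc m. laplacian_mat (Suc m) E a $$ (i, j) * of_real (f j))"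
      using con that
      by (subst laplacian_mat_mult_sum) (simp_all add: connected_graph_def)
    also have "\<dots> = (\<Sum>j<m. std_part (A $$ (i, j)) * v $ j)"
      using i AL by (simp add: std_part.hom_sum f_def)
    also have "\<dots> = (?A *\<^sub>v v) $ i"
      using i A v(1) by (simp add: scalar_prod_def atLeast0LessThan)
    also have "\<dots> = 0"
      using v(3) i by simp
    finally show ?thesis .
  qed
  have "f i = 0" if i: "i < m" for i
  proof (rule antisym)
    show "f i \<le> 0"
      using harmonic_le_boundary[OF con, of m i f] harm i by (simp add: f_def)
    \<comment> \<open>The lower bound is the maximum principle for \<open>- f\<close>.\<close>
    have "(\<Sum>j | j < Suc m \<and> {i, j} \<in> E. - f i - - f j) = 0" if "i < Suc m" "i \<noteq> m" for i
      using harm[OF that] by (simp add: sum_subtractf)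
    then show "0 \<le> f i"
      using harmonic_le_boundary[OF con, of m i "\<lambda>i. - f i"] i by (simp add: f_def)
  qed
  then have "v = 0\<^sub>v m"
    using v(1) by (intro eq_vecI) (auto simp: f_def)
  with v(2) show False by simp
qed

section \<open>The bordered inverse of a block matrix\<close>

lemma grounded_one_inverse:
  fixes A :: "'a :: ring_1 mat"
  assumes A: "A \<in> carrier_mat m m" and B: "B \<in> carrier_mat m k"
    and C: "C \<in> carrier_mat k m" and D: "D \<in> carrier_mat k k"
    and J: "J \<in> carrier_mat m k" and K: "K \<in> carrier_mat k m"
    and G: "G \<in> carrier_mat m m" "A * G = 1\<^sub>m m" "G * A = 1\<^sub>m m"
    and right: "four_block_mat A B C D * four_block_mat (0\<^sub>m m m) J (0\<^sub>m k m) (1\<^sub>m k)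
      = 0\<^sub>m (m + k) (m + k)"
    and left: "four_block_mat (0\<^sub>m m m) (0\<^sub>m m k) K (1\<^sub>m k) * four_block_mat A B C D
      = 0\<^sub>m (m + k) (m + k)"
  defines "L \<equiv> four_block_mat A B C D"
    and "M \<equiv> four_block_mat G (0\<^sub>m m k) (0\<^sub>m k m) (0\<^sub>m k k)"
  shows "1\<^sub>m (m + k) - M * L = four_block_mat (0\<^sub>m m m) J (0\<^sub>m k m) (1\<^sub>m k)" (is "_ = ?U")
    and "1\<^sub>m (m + k) - L * M = four_block_mat (0\<^sub>m m m) (0\<^sub>m m k) K (1\<^sub>m k)" (is "_ = ?V")
    and "M \<in> one_inverses L"
proof -
  have Lc: "L \<in> carrier_mat (m + k) (m + k)" and Mc: "M \<in> carrier_mat (m + k) (m + k)"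
    and Uc: "?U \<in> carrier_mat (m + k) (m + k)" and Vc: "?V \<in> carrier_mat (m + k) (m + k)"
    using A D G unfolding L_def M_def by auto
  have left_prod: "M * L = four_block_mat (1\<^sub>m m) (G * B) (0\<^sub>m k m) (0\<^sub>m k k)"
    unfolding L_def M_def using A B C D G
    by (subst mult_four_block_mat) auto
  have right_prod: "L * M = four_block_mat (1\<^sub>m m) (0\<^sub>m m k) (C * G) (0\<^sub>m k k)"
    unfolding L_def M_def using A B C D G
    by (subst mult_four_block_mat) auto
  \<comment> \<open>Multiplying \<open>right\<close> by \<open>M\<close> exposes, in the upper right
    block, \<open>J = - G * B\<close>, which is what identifies \<open>1 - M * L\<close> with
    \<open>?U\<close>. Dually, \<open>left\<close> gives \<open>K = - C * G\<close>.\<close>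
  have "M * L * ?U = M * (L * ?U)" by (rule assoc_mult_mat[OF Mc Lc Uc])
  then have MLU: "M * L * ?U = 0\<^sub>m (m + k) (m + k)"
    using right Mc unfolding L_def by simp
  have "?V * (L * M) = ?V * L * M" by (rule assoc_mult_mat[OF Vc Lc Mc, symmetric])
  then have VLM: "?V * (L * M) = 0\<^sub>m (m + k) (m + k)"
    using left Mc unfolding L_def by simp
  have "M * L * ?U = four_block_mat (0\<^sub>m m m) (J + G * B) (0\<^sub>m k m) (0\<^sub>m k k)"
    unfolding left_prod using J B G by (subst mult_four_block_mat) auto
  then have U_block: "four_block_mat (0\<^sub>m m m) (J + G * B) (0\<^sub>m k m) (0\<^sub>m k k) = 0\<^sub>m (m + k) (m + k)"
    using MLU by (rule subst)
  have GB: "- (row G i \<bullet> col B j) = J $$ (i, j)" if "i < m" "j < k" for i j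
    using arg_cong[OF U_block, of "\<lambda>X. X $$ (i, m + j)"] that J B G(1)
    by (simp add: neg_eq_iff_add_eq_0 add.commute)
  have "?V * (L * M) = four_block_mat (0\<^sub>m m m) (0\<^sub>m m k) (K + C * G) (0\<^sub>m k k)"
    unfolding right_prod using K C G by (subst mult_four_block_mat) auto
  then have V_block: "four_block_mat (0\<^sub>m m m) (0\<^sub>m m k) (K + C * G) (0\<^sub>m k k) = 0\<^sub>m (m + k) (m + k)"
    using VLM by (rule subst)
  have CG: "- (row C i \<bullet> col G j) = K $$ (i, j)" if "i < k" "j < m" for i j
    using arg_cong[OF V_block, of "\<lambda>X. X $$ (m + i, j)"] that K C G(1)
    by (simp add: neg_eq_iff_add_eq_0 add.commute)
  show U: "1\<^sub>m (m + k) - M * L = ?U"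
    unfolding left_prod using B G(1) J by (intro eq_matI) (auto simp: GB)
  show "1\<^sub>m (m + k) - L * M = ?V"
    unfolding right_prod using C G(1) K by (intro eq_matI) (auto simp: CG)
  \<comment> \<open>Now \<open>L * M * L = L - L * ?U\<close>, and the last product is zero by
    \<open>right\<close>.\<close>
  have "M * L = 1\<^sub>m (m + k) - ?U"
    unfolding left_prod using B G(1) J by (intro eq_matI) (auto simp: GB[symmetric])
  then have "L * (M * L) = L - L * ?U"
    using mult_minus_distrib_mat[OF Lc one_carrier_mat Uc] Lc by simp
  also have "\<dots> = L"
    using right minus_zero_mat[OF Lc] by (simp add: L_def)
  finally show "M \<in> one_inverses L"
    using Lc Mc by (simp add: one_inverses_def)
qed

theorem theorem3p2:
  fixes n :: nat and E :: "nat set set" and a :: "nat set \<Rightarrow> real"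
    and L11 L12 L22 :: "dual_number mat"
  assumes "connected_graph n E"
    and "L11 \<in> carrier_mat (n - 1) (n - 1)"
    and "L12 \<in> carrier_mat (n - 1) 1"
    and "L22 \<in> carrier_mat 1 1"
    and "laplacian_mat n E a = four_block_mat L11 L12 (transpose_mat L12) L22"
  shows "invertible_mat L11 \<and>
    four_block_mat (inv_mat L11) (0\<^sub>m (n - 1) 1) (0\<^sub>m 1 (n - 1)) (0\<^sub>m 1 1)
      \<in> one_inverses (laplacian_mat n E a) \<and>
    one_inverses (laplacian_mat n E a) =
      {four_block_mat (inv_mat L11) (0\<^sub>m (n - 1) 1) (0\<^sub>m 1 (n - 1)) (0\<^sub>m 1 1)
        + four_block_mat (0\<^sub>m (n - 1) (n - 1)) (ones_col (n - 1)) (0\<^sub>m 1 (n - 1)) (1\<^sub>m 1) * P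
        + Q * four_block_mat (0\<^sub>m (n - 1) (n - 1)) (0\<^sub>m (n - 1) 1)
                (transpose_mat (ones_col (n - 1))) (1\<^sub>m 1)
       | P Q. P \<in> carrier_mat n n \<and> Q \<in> carrier_mat n n}"
proof -
  have sg: "simple_graph n E" and "n \<noteq> 0"
    using assms(1) unfolding connected_graph_def by blast+
  then obtain m where n: "n = Suc m"
    by (cases n) simp_all
  define L where "L = laplacian_mat n E a"
  have L: "L = four_block_mat L11 L12 (transpose_mat L12) L22"
    unfolding L_def by (rule assms(5))
  have Lc: "L \<in> carrier_mat n n"
    unfolding L_def by (rule carrier_matI) simp_all
  have L11: "L11 \<in> carrier_mat m m" and L12: "L12 \<in> carrier_mat m 1"
    using assms(2,3) unfolding n by simp_all
  let ?J = "ones_col m :: dual_number mat"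
  let ?U = "four_block_mat (0\<^sub>m m m) ?J (0\<^sub>m 1 m) (1\<^sub>m 1)"
  let ?V = "four_block_mat (0\<^sub>m m m) (0\<^sub>m m 1) (transpose_mat ?J) (1\<^sub>m 1)"
  have J: "?J \<in> carrier_mat m 1"
    by (simp add: ones_col_def)
  have U: "?U = mat n n (\<lambda>(i, j). if j = m then 1 else 0)"
    by (rule eq_matI) (auto simp: n ones_col_def less_Suc_eq)
  have LU: "L * ?U = 0\<^sub>m (m + 1) (m + 1)"
    unfolding U L_def using laplacian_mat_mult_ones[OF sg, of a m] by (simp add: n)
  \<comment> \<open>By symmetry of the Laplacian, the left annihilation by \<open>?V\<close> is the
    transpose of \<open>L * ?U = 0\<close>.\<close>
  have "transpose_mat L = L"
    unfolding L_def by (rule transpose_laplacian_mat)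
  moreover have "transpose_mat ?U = ?V"
    using J by (subst transpose_four_block_mat) auto
  moreover have "transpose_mat (L * ?U) = transpose_mat ?U * transpose_mat L"
    using Lc n J by (intro transpose_mult) auto
  ultimately have VL: "?V * L = 0\<^sub>m (m + 1) (m + 1)"
    using LU by simp
  have "det (map_mat std_part L11) \<noteq> 0"
  proof (rule det_grounded_laplacian)
    show "connected_graph (Suc m) E" using assms(1) n by simp
    show "L11 $$ (i, j) = laplacian_mat (Suc m) E a $$ (i, j)" if "i < m" "j < m" for i j
    proof -
      have "L $$ (i, j) = L11 $$ (i, j)"
        unfolding L using that L11 assms(4) by simp
      then show ?thesis
        by (simp add: L_def n)
    qed
  qed fact
  then obtain G where G: "G \<in> carrier_mat m m" "L11 * G = 1\<^sub>m m" "G * L11 = 1\<^sub>m m"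
    using dual_mat_inverse[OF L11] by blast
  have inv: "square_mat L11" "inverts_mat L11 G" "inverts_mat G L11"
    using L11 G by (simp_all add: inverts_mat_def)
  then have inv_G: "inv_mat L11 = G" and "invertible_mat L11"
    using inv_mat_eqI[OF inv] by (simp, unfold invertible_mat_def, blast)
  \<comment> \<open>Here \<open>k = 1\<close>, the lower left block is the transpose of
    \<open>L12\<close>, and \<open>K\<close> is the row of ones.\<close>
  note grounded = grounded_one_inverse[OF L11 L12 _ assms(4) J _ G
      LU[unfolded L] VL[unfolded L], folded L]
  let ?M = "four_block_mat G (0\<^sub>m m 1) (0\<^sub>m 1 m) (0\<^sub>m 1 1)"
  have M: "?M \<in> one_inverses L"
    and left_prod: "1\<^sub>m n - ?M * L = ?U" and right_prod: "1\<^sub>m n - L * ?M = ?V"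
    using grounded L12 J n by simp_all
  have m: "n - 1 = m"
    by (simp add: n)
  have "one_inverses L = {?M + ?U * P + Q * ?V | P Q. P \<in> carrier_mat n n \<and> Q \<in> carrier_mat n n}"
    using one_inverses_eq[OF Lc M] unfolding left_prod right_prod .
  with \<open>invertible_mat L11\<close> M show ?thesis
    unfolding inv_G m L_def[symmetric] by (intro conjI)
qed

end
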